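(* With market data and the set UMFS as defined in the context, every point $(x,y,u,n,\pi,v,s,d^a,d^r,du^a,du^r)$ of UMFS satisfies $$\forall c\in C:\qquad \sum_{h\in H_c}(P_{hc}x_{hc})\,\pi_{l(hc),t(hc)}=\sum_{h\in H_c}(P_{hc}\lambda^{hc})\,x_{hc}-s_c .$$
   Context: **Data.** All index sets are finite. $I$ is the set of hourly bids $i$, $J$ the set of block bids $j$, $C$ the set of MIC bids $c$; each $c\in C$ has a set $H_c$ of hourly suborders, a suborder $h\in H_c$ being denoted $hc$. Locations are indexed by $l$, time slots by $t$. Each hourly bid $i$ (resp. suborder $hc$) has a location $l(i)$ (resp. $l(hc)$) and a time slot $t(i)$ (resp. $t(hc)$); each block bid $j$ has a location $l(j)$. $I_{lt}$ (resp. $HC_{lt}$) is the set of hourly bids (resp. of suborders of all MIC bids) with location $l$ and time slot $t$; $J_l$ is the set of block bids at location $l$. Real parameters: powers $P_i$, $P_{hc}$, $P^t_j$ (negative for sell, positive for buy), limit prices $\lambda^i,\lambda^{hc},\lambda^j$, network parameters $a_{m,k}$, $e^k_{l,t}$, $w_m$ ($m\in N$, $k\in K$). Write $P_j\lambda^j:=\sum_t P^t_j\lambda^j$. **Price bound and big-M constants.** $\bar\pi>0$ is a fixed real number such that all limit prices $\lambda^i,\lambda^{hc},\lambda^j$ lie in $[-\bar\pi,\bar\pi]$. $M_j$ ($j\in J$) and $M_c$ ($c\in C$) are fixed constants with $M_j\ge 2\bar\pi\sum_t|P^t_j|$ and $M_c\ge 2\bar\pi\sum_{h\in H_c}|P_{hc}|$.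 **Variables.** $x=((x_i)_{i\in I},(x_{hc})_{h\in H_c,c\in C})$, $y=(y_j)_{j\in J}$, $u=(u_c)_{c\in C}$, $n=(n_k)_{k\in K}$, $\pi=(\pi_{l,t})$, $v=(v_m)_{m\in N}$, $s=((s_i),(s_j),(s_{hc}),(s_c))$, $d^a,d^r$ (indexed by $J$), $du^a,du^r$ (indexed by $C$). All are real; $n$ and $\pi$ are free in sign. **UMFS** (Uniform Market Clearing Feasible Set) is the set of all points $(x,y,u,n,\pi,v,s,d^a,d^r,du^a,du^r)$ satisfying: - $\sum_i\lambda^iP_ix_i+\sum_{c\in C,h\in H_c}\lambda^{hc}P_{hc}x_{hc}+\sum_{j,t}\lambda^jP^t_jy_j\ \ge\ \sum_is_i+\sum_js_j+\sum_cs_c-\sum_{j\in J}d^a_j+\sum_mw_mv_m$; - $x_i\le1$ ($i\in I$); $y_j\le1$ ($j\in J$); $x_{hc}\le u_c$ ($h\in H_c,c\in C$); $u_c\le1$ ($c\in C$); - $\sum_{i\in I_{lt}}P_ix_i+\sum_{j\in J_l}P^t_jy_j+\sum_{hc\in HC_{lt}}P_{hc}x_{hc}=\sum_ke^k_{l,t}n_k$ for all $(l,t)$; $\sum_ka_{m,k}n_k\le w_m$ ($m\in N$); - $x,y,u\ge0$; $y,u$ integer; - $s_i+P_i\pi_{l(i),t(i)}\ge P_i\lambda^i$ ($i\in I$); $s_{hc}+P_{hc}\pi_{l(hc),t(hc)}\ge P_{hc}\lambda^{hc}$ ($h\in H_c,c\in C$); - $s_j+d^r_j-d^a_j+\sum_tP^t_j\pi_{l(j),t}\ge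 P_j\lambda^j$ ($j\in J$); $s_c+du^r_c\ge\sum_{h\in H_c}s_{hc}$ ($c\in C$); - $d^r_j\le M_j(1-y_j)$ and $d^a_j\le M_jy_j$ ($j\in J$); $du^r_c\le M_c(1-u_c)$ and $du^a_c=0$ ($c\in C$); - $\sum_ma_{m,k}v_m-\sum_{l,t}e^k_{l,t}\pi_{l,t}=0$ ($k\in K$); - all components of $s,d^a,d^r,du^a,du^r,v$ are $\ge0$. *)

theory Defs
  imports Complex_Main
begin

text \<open>
  Index sets are finite carrier sets inside arbitrary types, so any of them may be empty.
  A suborder \<open>hc\<close> (with \<open>h\<close> in \<open>H\<^sub>c\<close>) is given by the two
  arguments \<open>c h\<close>, so the same \<open>h\<close> may occur in several sets \<open>H\<^sub>c\<close>.
  Powers are negative for sell orders and positive for buy orders.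
\<close>

record ('i, 'j, 'c, 'h, 'l, 't, 'm, 'k) market =
  hourly :: "'i set"
  blocks :: "'j set"
  mics :: "'c set"
  suborders :: "'c \<Rightarrow> 'h set"
  locations :: "'l set"
  slots :: "'t set"
  net_constrs :: "'m set"  \<comment> \<open>the set \<open>N\<close>\<close>
  net_vars :: "'k set"  \<comment> \<open>the set \<open>K\<close>\<close>
  loc_I :: "'i \<Rightarrow> 'l"
  slot_I :: "'i \<Rightarrow> 't"
  loc_HC :: "'c \<Rightarrow> 'h \<Rightarrow> 'l"
  slot_HC :: "'c \<Rightarrow> 'h \<Rightarrow> 't"
  loc_J :: "'j \<Rightarrow> 'l"
  P_I :: "'i \<Rightarrow> real"
  P_HC :: "'c \<Rightarrow> 'h \<Rightarrow> real"
  P_J :: "'j \<Rightarrow> 't \<Rightarrow> real"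
  lim_I :: "'i \<Rightarrow> real"
  lim_HC :: "'c \<Rightarrow> 'h \<Rightarrow> real"
  lim_J :: "'j \<Rightarrow> real"
  net_a :: "'m \<Rightarrow> 'k \<Rightarrow> real"
  net_e :: "'k \<Rightarrow> 'l \<Rightarrow> 't \<Rightarrow> real"
  net_w :: "'m \<Rightarrow> real"
  price_bound :: real
  bigM_J :: "'j \<Rightarrow> real"
  bigM_C :: "'c \<Rightarrow> real"

definition market_data :: "('i, 'j, 'c, 'h, 'l, 't, 'm, 'k) market \<Rightarrow> bool" where
  "market_data D \<longleftrightarrow>
     finite (hourly D) \<and> finite (blocks D) \<and> finite (mics D) \<and>
     (\<forall>c\<in>mics D. finite (suborders D c)) \<and>
     finite (locations D) \<and> finite (slots D) \<and>
     finite (net_constrs D) \<and> finite (net_vars D) \<and>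
     (\<forall>i\<in>hourly D. loc_I D i \<in> locations D \<and> slot_I D i \<in> slots D) \<and>
     (\<forall>c\<in>mics D. \<forall>h\<in>suborders D c.
        loc_HC D c h \<in> locations D \<and> slot_HC D c h \<in> slots D) \<and>
     (\<forall>j\<in>blocks D. loc_J D j \<in> locations D) \<and>
     price_bound D > 0 \<and>
     (\<forall>i\<in>hourly D. lim_I D i \<in> {- price_bound D .. price_bound D}) \<and>
     (\<forall>c\<in>mics D. \<forall>h\<in>suborders D c.
        lim_HC D c h \<in> {- price_bound D .. price_bound D}) \<and>
     (\<forall>j\<in>blocks D. lim_J D j \<in> {- price_bound D .. price_bound D}) \<and>
     (\<forall>j\<in>blocks D. bigM_J D j \<ge> 2 * price_bound D * (\<Sum>t\<in>slots D. \<bar>P_J D j t\<bar>)) \<and>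
     (\<forall>c\<in>mics D. bigM_C D c \<ge> 2 * price_bound D * (\<Sum>h\<in>suborders D c. \<bar>P_HC D c h\<bar>))"

definition hourly_at :: "('i, 'j, 'c, 'h, 'l, 't, 'm, 'k) market \<Rightarrow> 'l \<Rightarrow> 't \<Rightarrow> 'i set" where
  "hourly_at D l t = {i \<in> hourly D. loc_I D i = l \<and> slot_I D i = t}"

definition blocks_at :: "('i, 'j, 'c, 'h, 'l, 't, 'm, 'k) market \<Rightarrow> 'l \<Rightarrow> 'j set" where
  "blocks_at D l = {j \<in> blocks D. loc_J D j = l}"

definition suborders_at ::
  "('i, 'j, 'c, 'h, 'l, 't, 'm, 'k) market \<Rightarrow> 'l \<Rightarrow> 't \<Rightarrow> ('c \<times> 'h) set" where
  "suborders_at D l t =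
     {(c, h). c \<in> mics D \<and> h \<in> suborders D c \<and> loc_HC D c h = l \<and> slot_HC D c h = t}"

record ('i, 'j, 'c, 'h, 'l, 't, 'm, 'k) market_point =
  x_I :: "'i \<Rightarrow> real"
  x_HC :: "'c \<Rightarrow> 'h \<Rightarrow> real"
  y_J :: "'j \<Rightarrow> real"
  u_C :: "'c \<Rightarrow> real"
  n_K :: "'k \<Rightarrow> real"
  price :: "'l \<Rightarrow> 't \<Rightarrow> real"  \<comment> \<open>\<open>\<pi>\<close>\<close>
  v_N :: "'m \<Rightarrow> real"
  s_I :: "'i \<Rightarrow> real"
  s_J :: "'j \<Rightarrow> real"
  s_HC :: "'c \<Rightarrow> 'h \<Rightarrow> real"
  s_C :: "'c \<Rightarrow> real"
  d_a :: "'j \<Rightarrow> real"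
  d_r :: "'j \<Rightarrow> real"
  du_a :: "'c \<Rightarrow> real"
  du_r :: "'c \<Rightarrow> real"

text \<open>
  Uniform Market Clearing Feasible Set. The constraints only concern the values of the
  components of a point on the index sets; values elsewhere are arbitrary.
\<close>

definition UMFS ::
  "('i, 'j, 'c, 'h, 'l, 't, 'm, 'k) market \<Rightarrow>
   ('i, 'j, 'c, 'h, 'l, 't, 'm, 'k) market_point set" where
  "UMFS D = {p.
     (\<Sum>i\<in>hourly D. lim_I D i * P_I D i * x_I p i)
       + (\<Sum>c\<in>mics D. \<Sum>h\<in>suborders D c. lim_HC D c h * P_HC D c h * x_HC p c h)
       + (\<Sum>j\<in>blocks D. \<Sum>t\<in>slots D. lim_J D j * P_J D j t * y_J p j)
     \<ge> (\<Sum>i\<in>hourly D. s_I p i) + (\<Sum>j\<in>blocks D. s_J p j) + (\<Sum>c\<in>mics D. s_C p c)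
       - (\<Sum>j\<in>blocks D. d_a p j) + (\<Sum>m\<in>net_constrs D. net_w D m * v_N p m) \<and>

     (\<forall>i\<in>hourly D. x_I p i \<le> 1) \<and>
     (\<forall>j\<in>blocks D. y_J p j \<le> 1) \<and>
     (\<forall>c\<in>mics D. \<forall>h\<in>suborders D c. x_HC p c h \<le> u_C p c) \<and>
     (\<forall>c\<in>mics D. u_C p c \<le> 1) \<and>

     (\<forall>l\<in>locations D. \<forall>t\<in>slots D.
        (\<Sum>i\<in>hourly_at D l t. P_I D i * x_I p i)
          + (\<Sum>j\<in>blocks_at D l. P_J D j t * y_J p j)
          + (\<Sum>(c, h)\<in>suborders_at D l t. P_HC D c h * x_HC p c h)
        = (\<Sum>k\<in>net_vars D. net_e D k l t * n_K p k)) \<and>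
     (\<forall>m\<in>net_constrs D. (\<Sum>k\<in>net_vars D. net_a D m k * n_K p k) \<le> net_w D m) \<and>

     (\<forall>i\<in>hourly D. x_I p i \<ge> 0) \<and>
     (\<forall>c\<in>mics D. \<forall>h\<in>suborders D c. x_HC p c h \<ge> 0) \<and>
     (\<forall>j\<in>blocks D. y_J p j \<ge> 0 \<and> y_J p j \<in> \<int>) \<and>
     (\<forall>c\<in>mics D. u_C p c \<ge> 0 \<and> u_C p c \<in> \<int>) \<and>

     (\<forall>i\<in>hourly D.
        s_I p i + P_I D i * price p (loc_I D i) (slot_I D i) \<ge> P_I D i * lim_I D i) \<and>
     (\<forall>c\<in>mics D. \<forall>h\<in>suborders D c.
        s_HC p c h + P_HC D c h * price p (loc_HC D c h) (slot_HC D c h)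
        \<ge> P_HC D c h * lim_HC D c h) \<and>
     (\<forall>j\<in>blocks D.
        s_J p j + d_r p j - d_a p j + (\<Sum>t\<in>slots D. P_J D j t * price p (loc_J D j) t)
        \<ge> (\<Sum>t\<in>slots D. P_J D j t * lim_J D j)) \<and>
     (\<forall>c\<in>mics D. s_C p c + du_r p c \<ge> (\<Sum>h\<in>suborders D c. s_HC p c h)) \<and>

     (\<forall>j\<in>blocks D.
        d_r p j \<le> bigM_J D j * (1 - y_J p j) \<and> d_a p j \<le> bigM_J D j * y_J p j) \<and>
     (\<forall>c\<in>mics D. du_r p c \<le> bigM_C D c * (1 - u_C p c) \<and> du_a p c = 0) \<and>

     (\<forall>k\<in>net_vars D.
        (\<Sum>m\<in>net_constrs D. net_a D m k * v_N p m)
          - (\<Sum>l\<in>locations D. \<Sum>t\<in>slots D. net_e D k l t * price p l t) = 0) \<and>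

     (\<forall>i\<in>hourly D. s_I p i \<ge> 0) \<and>
     (\<forall>j\<in>blocks D. s_J p j \<ge> 0) \<and>
     (\<forall>c\<in>mics D. \<forall>h\<in>suborders D c. s_HC p c h \<ge> 0) \<and>
     (\<forall>c\<in>mics D. s_C p c \<ge> 0) \<and>
     (\<forall>j\<in>blocks D. d_a p j \<ge> 0 \<and> d_r p j \<ge> 0) \<and>
     (\<forall>c\<in>mics D. du_a p c \<ge> 0 \<and> du_r p c \<ge> 0) \<and>
     (\<forall>m\<in>net_constrs D. v_N p m \<ge> 0)}"

end

theory Submission
  imports Defs
begin

text \<open>
  The first constraint of UMFS is the reverse of weak duality for the clearing problem with the
  integer variables fixed. By the dual constraints, the surplus variable of each bid is at least
  the surplus that the bid makes at the prices \<open>\<pi>\<close> (after a correction by \<open>d\<^sup>a\<close> for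
  blocks), and \<open>\<Sum> w v\<close> is at least the sum of all payments. Adding these inequalities
  contradicts the first constraint unless each of them is an equality; the equality for a MIC bid
  is the claim.
\<close>

lemma Ints_unit_cases:
  fixes x :: real
  assumes "x \<in> \<int>" "0 \<le> x" "x \<le> 1"
  obtains "x = 0" | "x = 1"
proof -
  from assms(1) obtain k where "x = of_int k" by (elim Ints_cases)
  with assms(2,3) have "k = 0 \<or> k = 1" by auto
  with \<open>x = of_int k\<close> that show thesis by auto
qed

text \<open>Read \<open>a\<close> as the value of a bid at its limit price, \<open>b\<close> as its
  cost at market prices and \<open>s\<close> as its surplus variable. Scaling the dual constraint
  \<open>a - b \<le> s\<close> by \<open>x \<ge> 0\<close> keeps it valid, and
  \<open>s * x \<le> s\<close> since \<open>s \<ge> 0\<close> and \<open>x \<le> 1\<close>.\<close>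

lemma surplus_le:
  fixes a b s x :: real
  assumes "a \<le> s + b" "0 \<le> s" "0 \<le> x" "x \<le> 1"
  shows "a * x - b * x \<le> s"
proof -
  have "(a - b) * x \<le> s * x" using assms by (intro mult_right_mono) auto
  also have "\<dots> \<le> s" using assms by (simp add: mult_left_le)
  finally show ?thesis by (simp add: algebra_simps)
qed

text \<open>The classes of equal location and slot partition \<open>S\<close>, and the weight
  \<open>q\<close> is constant on each class. This turns prices attached to the balance constraints
  into prices attached to bids.\<close>

lemma sum_group_pair:
  fixes f :: "'a \<Rightarrow> real"
  assumes "finite S" "finite L" "finite T" "\<And>i. i \<in> S \<Longrightarrow> loc i \<in> L \<and> slot i \<in> T"
  shows "(\<Sum>l\<in>L. \<Sum>t\<in>T. q l t * sum f {i \<in> S. loc i = l \<and> slot i = t})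
       = (\<Sum>i\<in>S. f i * q (loc i) (slot i))"
proof -
  have "(\<Sum>l\<in>L. \<Sum>t\<in>T. q l t * sum f {i \<in> S. loc i = l \<and> slot i = t})
      = (\<Sum>z\<in>L \<times> T. \<Sum>i\<in>{i \<in> S. (loc i, slot i) = z}. f i * q (loc i) (slot i))"
    by (auto simp: sum.cartesian_product sum_distrib_left mult.commute intro!: sum.cong)
  also have "\<dots> = (\<Sum>i\<in>S. f i * q (loc i) (slot i))"
    using assms by (intro sum.group) auto
  finally show ?thesis .
qed

lemma sum_nonneg_le_0:
  fixes f :: "'a \<Rightarrow> real"
  assumes "finite A" "\<And>x. x \<in> A \<Longrightarrow> 0 \<le> f x" "sum f A \<le> 0" "x \<in> A"
  shows "f x = 0"
proof -
  have "sum f A = 0" using assms(2,3) sum_nonneg[of A f] by force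
  with assms(1,2,4) show ?thesis by (simp add: sum_nonneg_eq_0_iff)
qed

context
  fixes D :: "('i, 'j, 'c, 'h, 'l, 't, 'm, 'k) market"
    and p :: "('i, 'j, 'c, 'h, 'l, 't, 'm, 'k) market_point"
  assumes data: "market_data D" and umfs: "p \<in> UMFS D"
begin

lemma hourly_surplus_le:
  assumes "i \<in> hourly D"
  shows "lim_I D i * P_I D i * x_I p i - P_I D i * x_I p i * price p (loc_I D i) (slot_I D i)
       \<le> s_I p i"
proof -
  have "P_I D i * lim_I D i \<le> s_I p i + P_I D i * price p (loc_I D i) (slot_I D i)"
    "0 \<le> s_I p i" "0 \<le> x_I p i" "x_I p i \<le> 1"
    using umfs assms unfolding UMFS_def by simp_all
  from surplus_le[OF this] show ?thesis by (simp add: mult_ac)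
qed

lemma block_surplus_le:
  assumes "j \<in> blocks D"
  shows "(\<Sum>t\<in>slots D. lim_J D j * P_J D j t * y_J p j)
         - (\<Sum>t\<in>slots D. P_J D j t * y_J p j * price p (loc_J D j) t)
       \<le> s_J p j - d_a p j"
proof -
  have dual: "(\<Sum>t\<in>slots D. P_J D j t * lim_J D j)
      \<le> s_J p j + d_r p j - d_a p j + (\<Sum>t\<in>slots D. P_J D j t * price p (loc_J D j) t)"
    and bigM: "d_r p j \<le> bigM_J D j * (1 - y_J p j)" "d_a p j \<le> bigM_J D j * y_J p j"
    and "0 \<le> s_J p j"
    and y: "y_J p j \<in> \<int>" "0 \<le> y_J p j" "y_J p j \<le> 1"
    using umfs assms unfolding UMFS_def by simp_all
  from y show ?thesis
  proof (cases rule: Ints_unit_cases)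
    \<comment> \<open>A rejected block has \<open>d_a \<le> 0\<close> by its big-M bound, and the
      left-hand side vanishes.\<close>
    case 1
    with bigM \<open>0 \<le> s_J p j\<close> show ?thesis by simp
  next
    \<comment> \<open>An accepted block has \<open>d_r \<le> 0\<close>, so the dual constraint gives
      the bound with \<open>d_a\<close> remaining as the correction.\<close>
    case 2
    with dual bigM show ?thesis by (simp add: mult.commute)
  qed
qed

lemma mic_surplus_le:
  assumes c: "c \<in> mics D"
  shows "(\<Sum>h\<in>suborders D c. lim_HC D c h * P_HC D c h * x_HC p c h)
         - (\<Sum>h\<in>suborders D c. P_HC D c h * x_HC p c h * price p (loc_HC D c h) (slot_HC D c h))
       \<le> s_C p c"
proof -
  have dual: "(\<Sum>h\<in>suborders D c. s_HC p c h) \<le> s_C p c + du_r p c"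
    and bigM: "du_r p c \<le> bigM_C D c * (1 - u_C p c)"
    and s: "0 \<le> s_C p c"
    and u: "u_C p c \<in> \<int>" "0 \<le> u_C p c" "u_C p c \<le> 1"
    using umfs c unfolding UMFS_def by simp_all
  have sub: "P_HC D c h * lim_HC D c h
        \<le> s_HC p c h + P_HC D c h * price p (loc_HC D c h) (slot_HC D c h)"
      "0 \<le> s_HC p c h" "0 \<le> x_HC p c h" "x_HC p c h \<le> u_C p c" if "h \<in> suborders D c" for h
    using umfs c that unfolding UMFS_def by simp_all
  from u show ?thesis
  proof (cases rule: Ints_unit_cases)
    \<comment> \<open>\<open>0 \<le> x_HC \<le> u_C\<close> forces every suborder of a rejected MIC
      bid to zero.\<close>
    case 1
    then have "x_HC p c h = 0" if "h \<in> suborders D c" for h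
      using sub(3,4)[OF that] by simp
    with s show ?thesis by simp
  next
    \<comment> \<open>With \<open>u_C = 1\<close>, \<open>surplus_le\<close> bounds each suborder by
      its own \<open>s_HC\<close>. As \<open>du_r \<le> 0\<close>, the sum of these is at most
      \<open>s_C\<close>.\<close>
    case 2
    have "lim_HC D c h * P_HC D c h * x_HC p c h
          - P_HC D c h * x_HC p c h * price p (loc_HC D c h) (slot_HC D c h) \<le> s_HC p c h"
      if "h \<in> suborders D c" for h
      using surplus_le[of "P_HC D c h * lim_HC D c h" _ _ "x_HC p c h", OF sub(1,2,3)[OF that]]
        sub(4)[OF that] 2
      by (simp add: mult_ac)
    then have "(\<Sum>h\<in>suborders D c. lim_HC D c h * P_HC D c h * x_HC p c h
          - P_HC D c h * x_HC p c h * price p (loc_HC D c h) (slot_HC D c h))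
        \<le> (\<Sum>h\<in>suborders D c. s_HC p c h)"
      by (rule sum_mono)
    with dual bigM 2 show ?thesis by (simp add: sum_subtractf)
  qed
qed

text \<open>Multiply each balance constraint by the price at its location and slot, add them all up,
  and regroup the left-hand side by bids.\<close>

lemma payments_eq_network_value:
  "(\<Sum>i\<in>hourly D. P_I D i * x_I p i * price p (loc_I D i) (slot_I D i))
     + (\<Sum>j\<in>blocks D. \<Sum>t\<in>slots D. P_J D j t * y_J p j * price p (loc_J D j) t)
     + (\<Sum>c\<in>mics D. \<Sum>h\<in>suborders D c.
          P_HC D c h * x_HC p c h * price p (loc_HC D c h) (slot_HC D c h))
   = (\<Sum>l\<in>locations D. \<Sum>t\<in>slots D. price p l t * (\<Sum>k\<in>net_vars D. net_e D k l t * n_K p k))"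
  (is "?I + ?J + ?C = ?N")
proof -
  have fin: "finite (hourly D)" "finite (blocks D)" "finite (mics D)"
      "finite (locations D)" "finite (slots D)" "\<forall>c\<in>mics D. finite (suborders D c)"
    and locI: "\<forall>i\<in>hourly D. loc_I D i \<in> locations D \<and> slot_I D i \<in> slots D"
    and locC: "\<forall>c\<in>mics D. \<forall>h\<in>suborders D c.
        loc_HC D c h \<in> locations D \<and> slot_HC D c h \<in> slots D"
    and locJ: "\<forall>j\<in>blocks D. loc_J D j \<in> locations D"
    using data unfolding market_data_def by simp_all
  have balance: "(\<Sum>k\<in>net_vars D. net_e D k l t * n_K p k)
      = (\<Sum>i\<in>hourly_at D l t. P_I D i * x_I p i) + (\<Sum>j\<in>blocks_at D l. P_J D j t * y_J p j)
        + (\<Sum>(c, h)\<in>suborders_at D l t. P_HC D c h * x_HC p c h)"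
    if "l \<in> locations D" "t \<in> slots D" for l t
    using umfs that unfolding UMFS_def by simp
  have I: "(\<Sum>l\<in>locations D. \<Sum>t\<in>slots D.
      price p l t * (\<Sum>i\<in>hourly_at D l t. P_I D i * x_I p i)) = ?I"
    unfolding hourly_at_def using fin locI by (intro sum_group_pair) auto
  \<comment> \<open>Suborders are indexed by pairs, so location and slot are uncurried to match the
    form of \<open>sum_group_pair\<close>.\<close>
  have "suborders_at D l t = {z \<in> Sigma (mics D) (suborders D).
      (case z of (c, h) \<Rightarrow> loc_HC D c h) = l \<and> (case z of (c, h) \<Rightarrow> slot_HC D c h) = t}" for l t
    unfolding suborders_at_def by auto
  then have "(\<Sum>l\<in>locations D. \<Sum>t\<in>slots D.
        price p l t * (\<Sum>(c, h)\<in>suborders_at D l t. P_HC D c h * x_HC p c h))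
      = (\<Sum>z\<in>Sigma (mics D) (suborders D). (case z of (c, h) \<Rightarrow> P_HC D c h * x_HC p c h)
          * price p (case z of (c, h) \<Rightarrow> loc_HC D c h) (case z of (c, h) \<Rightarrow> slot_HC D c h))"
    using fin locC by (simp only:, intro sum_group_pair) auto
  also have "\<dots> = ?C"
    using fin by (subst sum.Sigma) (auto intro!: sum.cong)
  finally have C: "(\<Sum>l\<in>locations D. \<Sum>t\<in>slots D.
      price p l t * (\<Sum>(c, h)\<in>suborders_at D l t. P_HC D c h * x_HC p c h)) = ?C" .
  \<comment> \<open>A block has one location but runs over all slots, so the slot sum moves inside
    and only locations are grouped.\<close>
  have "(\<Sum>l\<in>locations D. \<Sum>t\<in>slots D.
        price p l t * (\<Sum>j\<in>blocks_at D l. P_J D j t * y_J p j))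
      = (\<Sum>l\<in>locations D. \<Sum>j\<in>{j \<in> blocks D. loc_J D j = l}.
          \<Sum>t\<in>slots D. P_J D j t * y_J p j * price p (loc_J D j) t)"
    unfolding blocks_at_def sum_distrib_left
    by (rule sum.cong[OF refl], subst sum.swap) (simp add: mult_ac)
  also have "\<dots> = ?J"
    using fin locJ by (intro sum.group) auto
  finally have J: "(\<Sum>l\<in>locations D. \<Sum>t\<in>slots D.
      price p l t * (\<Sum>j\<in>blocks_at D l. P_J D j t * y_J p j)) = ?J" .
  have "?N = (\<Sum>l\<in>locations D. \<Sum>t\<in>slots D.
        price p l t * (\<Sum>i\<in>hourly_at D l t. P_I D i * x_I p i)
      + price p l t * (\<Sum>j\<in>blocks_at D l. P_J D j t * y_J p j)
      + price p l t * (\<Sum>(c, h)\<in>suborders_at D l t. P_HC D c h * x_HC p c h))"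
    by (intro sum.cong refl) (simp only: balance distrib_left)
  then show ?thesis
    unfolding sum.distrib I J C by simp
qed

text \<open>Weak duality for the network: exchanging sums lets the dual equation of each
  \<open>k\<close> replace prices by \<open>v_N\<close>, after which the capacity constraints apply,
  weighted by \<open>v_N \<ge> 0\<close>.\<close>

lemma network_value_le:
  "(\<Sum>l\<in>locations D. \<Sum>t\<in>slots D. price p l t * (\<Sum>k\<in>net_vars D. net_e D k l t * n_K p k))
   \<le> (\<Sum>m\<in>net_constrs D. net_w D m * v_N p m)"
  (is "?N \<le> _")
proof -
  have cap: "(\<Sum>k\<in>net_vars D. net_a D m k * n_K p k) \<le> net_w D m" and "0 \<le> v_N p m"
    if "m \<in> net_constrs D" for m
    using umfs that unfolding UMFS_def by simp_all
  have dual: "(\<Sum>l\<in>locations D. \<Sum>t\<in>slots D. net_e D k l t * price p l t)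
      = (\<Sum>m\<in>net_constrs D. net_a D m k * v_N p m)" if "k \<in> net_vars D" for k
    using umfs that unfolding UMFS_def by simp
  have "?N = (\<Sum>l\<in>locations D. \<Sum>k\<in>net_vars D. \<Sum>t\<in>slots D.
      n_K p k * (net_e D k l t * price p l t))"
    unfolding sum_distrib_left
    by (rule sum.cong[OF refl], subst sum.swap) (simp only: mult_ac)
  also have "\<dots> = (\<Sum>k\<in>net_vars D.
      n_K p k * (\<Sum>l\<in>locations D. \<Sum>t\<in>slots D. net_e D k l t * price p l t))"
    unfolding sum_distrib_left by (rule sum.swap)
  \<comment> \<open>The dual constraint of \<open>k\<close> is an equation, so the sign of
    \<open>n_K p k\<close> does not matter.\<close>
  also have "\<dots> = (\<Sum>k\<in>net_vars D. \<Sum>m\<in>net_constrs D. net_a D m k * n_K p k * v_N p m)"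
    by (rule sum.cong[OF refl], subst dual) (simp_all add: sum_distrib_left mult_ac)
  also have "\<dots> = (\<Sum>m\<in>net_constrs D. (\<Sum>k\<in>net_vars D. net_a D m k * n_K p k) * v_N p m)"
    unfolding sum_distrib_right by (rule sum.swap)
  also have "\<dots> \<le> (\<Sum>m\<in>net_constrs D. net_w D m * v_N p m)"
    by (intro sum_mono mult_right_mono cap \<open>\<And>m. m \<in> net_constrs D \<Longrightarrow> 0 \<le> v_N p m\<close>)
  finally show ?thesis .
qed

end

theorem lemma3:
  fixes D :: "('i, 'j, 'c, 'h, 'l, 't, 'm, 'k) market"
    and p :: "('i, 'j, 'c, 'h, 'l, 't, 'm, 'k) market_point"
  assumes "market_data D"
    and "p \<in> UMFS D"
  shows "\<forall>c\<in>mics D.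
    (\<Sum>h\<in>suborders D c.
       (P_HC D c h * x_HC p c h) * price p (loc_HC D c h) (slot_HC D c h))
    = (\<Sum>h\<in>suborders D c. (P_HC D c h * lim_HC D c h) * x_HC p c h) - s_C p c"
proof
  fix c assume c: "c \<in> mics D"
  \<comment> \<open>\<open>gap c\<close> is the slack in \<open>mic_surplus_le\<close>; its
    vanishing is the claim for \<open>c\<close>. Since all gaps are nonnegative, it suffices that
    their sum is at most 0.\<close>
  define gap where "gap c = s_C p c
      - ((\<Sum>h\<in>suborders D c. lim_HC D c h * P_HC D c h * x_HC p c h)
         - (\<Sum>h\<in>suborders D c. P_HC D c h * x_HC p c h * price p (loc_HC D c h) (slot_HC D c h)))"
    for c
  have "gap c = 0"
  proof (rule sum_nonneg_le_0[OF _ _ _ c])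
    show "finite (mics D)" using assms(1) unfolding market_data_def by simp
    show "0 \<le> gap c" if "c \<in> mics D" for c
      using mic_surplus_le[OF assms that] by (simp add: gap_def)
    have "(\<Sum>i\<in>hourly D. s_I p i) + (\<Sum>j\<in>blocks D. s_J p j) + (\<Sum>c\<in>mics D. s_C p c)
          - (\<Sum>j\<in>blocks D. d_a p j) + (\<Sum>m\<in>net_constrs D. net_w D m * v_N p m)
        \<le> (\<Sum>i\<in>hourly D. lim_I D i * P_I D i * x_I p i)
          + (\<Sum>c\<in>mics D. \<Sum>h\<in>suborders D c. lim_HC D c h * P_HC D c h * x_HC p c h)
          + (\<Sum>j\<in>blocks D. \<Sum>t\<in>slots D. lim_J D j * P_J D j t * y_J p j)"
      using assms(2) unfolding UMFS_def by simp
    \<comment> \<open>Inserting the hourly and block bounds into the first constraint bounds the sum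
      of the gaps by the total payments minus \<open>\<Sum> w v\<close>, which is at most 0 by the
      two network lemmas.\<close>
    moreover note sum_mono[OF hourly_surplus_le[OF assms], of "hourly D" "\<lambda>i. i"]
      sum_mono[OF block_surplus_le[OF assms], of "blocks D" "\<lambda>j. j"]
      payments_eq_network_value[OF assms] network_value_le[OF assms]
    ultimately show "sum gap (mics D) \<le> 0"
      unfolding gap_def sum_subtractf by linarith
  qed
  then show "(\<Sum>h\<in>suborders D c.
       (P_HC D c h * x_HC p c h) * price p (loc_HC D c h) (slot_HC D c h))
    = (\<Sum>h\<in>suborders D c. (P_HC D c h * lim_HC D c h) * x_HC p c h) - s_C p c"
    by (simp add: gap_def mult_ac)
qed

end
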